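(* Let $\mathcal V$ be the convex set of all nonnegative real arrays $V=(V_{nk}:\ 0\le k\le n-1,\ n=1,2,\dots)$ satisfying $V_{10}=1$ and $$V_{nk}=(k+1)V_{n+1,k}+(n-k)V_{n+1,k+1}\qquad(0\le k\le n-1,\ n=1,2,\dots),$$ and let $\mathrm{ex}(\mathcal V)$ be the set of extreme points of $\mathcal V$. Let $$\Theta=\left\{\tfrac12\cdot\tfrac{\varkappa}{\varkappa+1}:\ \varkappa=0,1,2,\dots\right\}\cup\left\{\tfrac12\right\}\cup\left\{\tfrac12\cdot\tfrac{\varkappa+2}{\varkappa+1}:\ \varkappa=0,1,2,\dots\right\}\subset[0,1].$$ Then every extreme solution $W=(W_{nk})\in\mathrm{ex}(\mathcal V)$ is uniquely determined by the parameter $\theta:=W_{20}$, which assumes values in $\Theta$, and the correspondence $W\mapsto W_{20}$ between $\mathrm{ex}(\mathcal V)$ and $\Theta$ is a homeomorphism (of $\mathrm{ex}(\mathcal V)$ onto $\Theta$).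
   Context: The set $\mathcal V$ (and its subset $\mathrm{ex}(\mathcal V)$) carries the topology of pointwise (entrywise) convergence of arrays; $\Theta$ carries the topology induced from $\mathbb R$. *)

theory Defs
  imports "HOL-Analysis.Analysis" "HOL-Library.Function_Algebras"
begin

(* HOL-Library makes functions an abelian group under pointwise addition but provides no
   scalar multiplication; it is needed for convex and extreme_point_of on spaces of arrays. *)
instantiation "fun" :: (type, real_vector) real_vector
begin

definition scaleR_fun :: "real \<Rightarrow> ('a \<Rightarrow> 'b) \<Rightarrow> 'a \<Rightarrow> 'b"
  where "scaleR_fun c f = (\<lambda>x. c *\<^sub>R f x)"

instance
  by standard (simp_all add: scaleR_fun_def fun_eq_iff scaleR_add_right scaleR_add_left)

end

lemma scaleR_fun_apply [simp]: "(c *\<^sub>R f) x = c *\<^sub>R f x"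
  by (simp add: scaleR_fun_def)

(* An array (V_nk : 0 <= k <= n-1, n >= 1) is a function of n and k. The entries outside the
   triangle k < n carry no information and are set to 0, so that equality of functions is
   equality of arrays. The topology on the function type is the product topology, that is,
   the topology of entrywise convergence. *)
definition eulerian_arrays :: "(nat \<Rightarrow> nat \<Rightarrow> real) set"
  where "eulerian_arrays = {V.
    (\<forall>n k. k < n \<longrightarrow> 0 \<le> V n k) \<and>
    (\<forall>n k. \<not> k < n \<longrightarrow> V n k = 0) \<and>
    V 1 0 = 1 \<and>
    (\<forall>n k. k < n \<longrightarrow>
      V n k = (real k + 1) * V (n + 1) k + (real n - real k) * V (n + 1) (k + 1))}"

lemma eulerian_arraysD:
  assumes "V \<in> eulerian_arrays"
  shows "k < n \<Longrightarrow> 0 \<le> V n k"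
    and "\<not> k < n \<Longrightarrow> V n k = 0"
    and "V 1 0 = 1"
    and "k < n \<Longrightarrow>
      V n k = (real k + 1) * V (n + 1) k + (real n - real k) * V (n + 1) (k + 1)"
  using assms unfolding eulerian_arrays_def mem_Collect_eq
  by iprover+

lemma convex_eulerian_arrays: "convex eulerian_arrays"
proof (rule convexI)
  fix A B :: "nat \<Rightarrow> nat \<Rightarrow> real" and u v :: real
  assume A: "A \<in> eulerian_arrays" and B: "B \<in> eulerian_arrays"
    and uv: "0 \<le> u" "0 \<le> v" "u + v = 1"
  note a = eulerian_arraysD[OF A] and b = eulerian_arraysD[OF B]
  have rec: "u * A n k + v * B n k =
      (real k + 1) * (u * A (n + 1) k + v * B (n + 1) k) +
      (real n - real k) * (u * A (n + 1) (k + 1) + v * B (n + 1) (k + 1))" if "k < n" for n k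
    unfolding a(4)[OF that] b(4)[OF that] by (simp add: algebra_simps)
  have nonneg: "0 \<le> u * A n k + v * B n k" if "k < n" for n k
    by (intro add_nonneg_nonneg mult_nonneg_nonneg uv(1,2) a(1)[OF that] b(1)[OF that])
  have zero: "u * A n k + v * B n k = 0" if "\<not> k < n" for n k
    unfolding a(2)[OF that] b(2)[OF that] by simp
  have one: "u * A 1 0 + v * B 1 0 = 1"
    unfolding a(3) b(3) using uv(3) by simp
  show "u *\<^sub>R A + v *\<^sub>R B \<in> eulerian_arrays"
    unfolding eulerian_arrays_def mem_Collect_eq plus_fun_apply scaleR_fun_apply real_scaleR_def
    by (intro conjI allI impI) (rule nonneg zero one rec, assumption?)+
qed

definition extreme_arrays :: "(nat \<Rightarrow> nat \<Rightarrow> real) set"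
  where "extreme_arrays = {W. W extreme_point_of eulerian_arrays}"

definition Theta :: "real set"
  where "Theta =
    range (\<lambda>m::nat. 1/2 * (real m / (real m + 1))) \<union> {1/2} \<union>
    range (\<lambda>m::nat. 1/2 * ((real m + 2) / (real m + 1)))"

end

theory Submission
  imports Defs
begin

text \<open>
  Put \<open>W\<^sub>t(n,k) = (\<Prod>i<n. 1 + t (i - k)) / n!\<close>. For every real \<open>t\<close> this array solves the
  Eulerian recursion, and it is nonnegative exactly when \<open>t = 0\<close> or \<open>t = 1/m\<close> or \<open>t = - 1/m\<close>
  for an integer \<open>m \<ge> 1\<close>. (For \<open>t = 1/m\<close> it gives the probability of each permutation of \<open>n\<close>
  letters with \<open>k\<close> descents after an inverse \<open>m\<close>-shuffle.) As \<open>W\<^sub>t(2,0) = (1 + t) / 2\<close>,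
  these \<open>t\<close> correspond to the points of \<open>\<Theta>\<close>, and since the entries of \<open>W\<^sub>t\<close> are polynomials in
  \<open>t\<close>, all that matters is that the extreme arrays are precisely the nonnegative \<open>W\<^sub>t\<close>.

  The tool is the operator \<open>P\<close> (called \<open>tilt\<close> below) on solutions which corresponds to
  multiplying \<open>W\<^sub>t\<close> by the number \<open>(1 + t) / 2\<close>. Such an operator exists because
  \<open>t W\<^sub>t(n,k) = W\<^sub>t(n+1,k) - W\<^sub>t(n+1,k+1)\<close>. Both \<open>P\<close> and \<open>1 - P\<close> map nonnegative solutions to
  nonnegative solutions, just as \<open>(1 + t) / 2\<close> and \<open>(1 - t) / 2\<close> are nonnegative on \<open>[-1,1]\<close>.

  Extreme arrays are eigenarrays of \<open>P\<close>: the decomposition \<open>V = P V + (1 - P) V\<close> of an extreme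
  \<open>V\<close> must be trivial, so \<open>P V = \<theta> V\<close>, and comparing the entries at \<open>(1,0)\<close> gives
  \<open>\<theta> = V(2,0)\<close>. This equation together with the recursion determines \<open>V\<close> level by level, so
  \<open>V = W\<^sub>t\<close> with \<open>t = 2 \<theta> - 1\<close>.

  Eigenarrays of \<open>P\<close> are extreme: positivity of \<open>P\<close> and \<open>1 - P\<close> yields, by an argument in the
  style of Bernstein polynomials, \<open>(P - s)\<^sup>2 V \<ge> 0\<close> for every nonnegative solution \<open>V\<close> and every
  real \<open>s\<close>. If an eigenarray with eigenvalue \<open>\<theta>\<close> is a proper mixture of \<open>A\<close> and \<open>B\<close>, then
  \<open>(P - \<theta>)\<^sup>2 A = 0\<close>, that is, the variance of the parameter under \<open>A\<close> vanishes; therefore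
  \<open>P A = \<theta> A\<close>, and likewise for \<open>B\<close>, so that \<open>A = B\<close>.
\<close>


section \<open>Nonnegative solutions of the Eulerian recursion and the tilt operator\<close>

definition eulerian_cone :: "(nat \<Rightarrow> nat \<Rightarrow> real) set"
  where "eulerian_cone = {V.
    (\<forall>n k. k < n \<longrightarrow> 0 \<le> V n k) \<and>
    (\<forall>n k. \<not> k < n \<longrightarrow> V n k = 0) \<and>
    (\<forall>n k. k < n \<longrightarrow>
      V n k = (real k + 1) * V (n + 1) k + (real n - real k) * V (n + 1) (k + 1))}"

lemma eulerian_arrays_eq_cone: "V \<in> eulerian_arrays \<longleftrightarrow> V \<in> eulerian_cone \<and> V 1 0 = 1"
  unfolding eulerian_arrays_def eulerian_cone_def by blast

lemma eulerian_coneD: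
  assumes "V \<in> eulerian_cone"
  shows "0 \<le> V n k"
    and "\<not> k < n \<Longrightarrow> V n k = 0"
    and "k < n \<Longrightarrow>
      V n k = (real k + 1) * V (n + 1) k + (real n - real k) * V (n + 1) (k + 1)"
proof -
  have nonneg: "\<forall>n k. k < n \<longrightarrow> 0 \<le> V n k" and zero: "\<forall>n k. \<not> k < n \<longrightarrow> V n k = 0"
    and rec: "\<forall>n k. k < n \<longrightarrow>
      V n k = (real k + 1) * V (n + 1) k + (real n - real k) * V (n + 1) (k + 1)"
    using assms unfolding eulerian_cone_def by blast+
  show "0 \<le> V n k"
    using nonneg zero by (cases "k < n") auto
  show "\<not> k < n \<Longrightarrow> V n k = 0"
    using zero by blast
  show "k < n \<Longrightarrow>
      V n k = (real k + 1) * V (n + 1) k + (real n - real k) * V (n + 1) (k + 1)"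
    using rec by blast
qed

lemma eulerian_coneI:
  assumes "\<And>n k. k < n \<Longrightarrow> 0 \<le> V n k"
    and "\<And>n k. \<not> k < n \<Longrightarrow> V n k = 0"
    and "\<And>n k. k < n \<Longrightarrow>
      V n k = (real k + 1) * V (n + 1) k + (real n - real k) * V (n + 1) (k + 1)"
  shows "V \<in> eulerian_cone"
  using assms unfolding eulerian_cone_def by blast

lemma eulerian_cone_scale:
  assumes V: "V \<in> eulerian_cone" and c: "0 \<le> c"
  shows "(\<lambda>n k. c * V n k) \<in> eulerian_cone"
proof (rule eulerian_coneI)
  fix n k :: nat assume "k < n"
  show "c * V n k = (real k + 1) * (c * V (n + 1) k) + (real n - real k) * (c * V (n + 1) (k + 1))"
    unfolding eulerian_coneD(3)[OF V \<open>k < n\<close>] by (simp add: algebra_simps)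
qed (use c eulerian_coneD(1,2)[OF V] in auto)

text \<open>
  Both coefficients of the recursion are positive for \<open>k < n\<close>, so a zero in a nonnegative
  solution spreads downwards from the top entry through the whole triangle.
\<close>

lemma eulerian_cone_vanishes:
  assumes V: "V \<in> eulerian_cone" and "V 1 0 = 0"
  shows "V n k = 0"
proof -
  have "\<forall>k. V (Suc n) k = 0" for n
  proof (induction n)
    case 0
    have "V 1 k = 0" for k
      using assms(2) eulerian_coneD(2)[OF V, of k 1] by (cases k) auto
    then show ?case by simp
  next
    case (Suc n)
    have both: "V (Suc (Suc n)) k = 0 \<and> V (Suc (Suc n)) (Suc k) = 0" if k: "k < Suc n" for k
    proof -
      have "(real k + 1) * V (Suc (Suc n)) k
          + (real (Suc n) - real k) * V (Suc (Suc n)) (Suc k) = 0"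
        using eulerian_coneD(3)[OF V k] Suc.IH by simp
      moreover have "0 < real k + 1" "0 < real (Suc n) - real k"
        using k by auto
      ultimately show ?thesis
        using eulerian_coneD(1)[OF V, of "Suc (Suc n)" k]
          eulerian_coneD(1)[OF V, of "Suc (Suc n)" "Suc k"]
        by (simp add: add_nonneg_eq_0_iff)
    qed
    have "V (Suc (Suc n)) k = 0" for k
    proof (cases "k < Suc n")
      case True
      then show ?thesis using both by blast
    next
      case False
      show ?thesis
      proof (cases "k = Suc n")
        case True
        then show ?thesis using both[of n] by simp
      next
        case ne: False
        then show ?thesis
          using False by (intro eulerian_coneD(2)[OF V]) linarith
      qed
    qed
    then show ?case by blast
  qed
  then show ?thesis
    using eulerian_coneD(2)[OF V, of k n] by (cases n) auto
qed

text \<open>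
  The difference \<open>V (n + 1) k - V (n + 1) (k + 1)\<close> acts on solutions as multiplication by the
  parameter \<open>t\<close>, so \<open>tilt\<close> acts as multiplication by \<open>(1 + t) / 2\<close>.
\<close>

definition tilt :: "(nat \<Rightarrow> nat \<Rightarrow> real) \<Rightarrow> nat \<Rightarrow> nat \<Rightarrow> real"
  where "tilt V n k = (if k < n then (V n k + V (n + 1) k - V (n + 1) (k + 1)) / 2 else 0)"

lemma twice_tilt:
  "k < n \<Longrightarrow> 2 * tilt V n k = V n k + V (n + 1) k - V (n + 1) (k + 1)"
  by (simp add: tilt_def)

lemma tilt_recursion:
  assumes V: "V \<in> eulerian_cone" and k: "k < n"
  shows "tilt V n k
    = (real k + 1) * tilt V (n + 1) k + (real n - real k) * tilt V (n + 1) (k + 1)"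
proof -
  have "V (n + 1) k
      = (real k + 1) * V (n + 2) k + (real n + 1 - real k) * V (n + 2) (k + 1)"
    using eulerian_coneD(3)[OF V, of k "n + 1"] k by simp
  moreover have "V (n + 1) (k + 1)
      = (real k + 2) * V (n + 2) (k + 1) + (real n - real k) * V (n + 2) (k + 2)"
    using eulerian_coneD(3)[OF V, of "k + 1" "n + 1"] k by (simp add: add.commute)
  ultimately show ?thesis
    using k eulerian_coneD(3)[OF V k] by (simp add: tilt_def field_simps)
qed

text \<open>
  After the recursion is substituted for \<open>V n k\<close>, the coefficients of \<open>tilt V n k\<close> are
  \<open>(k + 2) / 2\<close> and \<open>(n - k - 1) / 2\<close>, and those of the complement are \<open>k / 2\<close> and
  \<open>(n - k + 1) / 2\<close>. All of them are nonnegative for \<open>k < n\<close>.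
\<close>

lemma tilt_in_cone:
  assumes V: "V \<in> eulerian_cone"
  shows "tilt V \<in> eulerian_cone"
proof (rule eulerian_coneI)
  fix n k :: nat assume k: "k < n"
  have "2 * tilt V n k
      = (real k + 2) * V (n + 1) k + (real n - real k - 1) * V (n + 1) (k + 1)"
    using eulerian_coneD(3)[OF V k] unfolding twice_tilt[OF k] by (simp add: algebra_simps)
  also have "\<dots> \<ge> 0"
    using k by (intro add_nonneg_nonneg mult_nonneg_nonneg eulerian_coneD(1)[OF V]) auto
  finally show "0 \<le> tilt V n k" by simp
qed (simp add: tilt_def, rule tilt_recursion[OF V])

lemma tilt_complement_in_cone:
  assumes V: "V \<in> eulerian_cone"
  shows "(\<lambda>n k. V n k - tilt V n k) \<in> eulerian_cone"
proof (rule eulerian_coneI)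
  fix n k :: nat assume k: "k < n"
  have "2 * (V n k - tilt V n k)
      = real k * V (n + 1) k + (real n - real k + 1) * V (n + 1) (k + 1)"
    using eulerian_coneD(3)[OF V k] unfolding right_diff_distrib twice_tilt[OF k]
    by (simp add: algebra_simps)
  also have "\<dots> \<ge> 0"
    using k by (intro add_nonneg_nonneg mult_nonneg_nonneg eulerian_coneD(1)[OF V]) auto
  finally show "0 \<le> V n k - tilt V n k" by simp
  show "V n k - tilt V n k
      = (real k + 1) * (V (n + 1) k - tilt V (n + 1) k)
        + (real n - real k) * (V (n + 1) (k + 1) - tilt V (n + 1) (k + 1))"
    unfolding tilt_recursion[OF V k] eulerian_coneD(3)[OF V k] by (simp add: algebra_simps)
qed (simp add: tilt_def eulerian_coneD(2)[OF V])

lemma tilt_1_0: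
  assumes "V \<in> eulerian_cone"
  shows "tilt V 1 0 = V 2 0"
  using eulerian_coneD(3)[OF assms, of 0 1] by (simp add: tilt_def numeral_2_eq_2)

lemma tilt_linear: "tilt (\<lambda>n k. a * A n k + b * B n k) n k = a * tilt A n k + b * tilt B n k"
  by (simp add: tilt_def field_simps)


section \<open>The eigenarrays of the tilt operator\<close>

definition shuffle_array :: "real \<Rightarrow> nat \<Rightarrow> nat \<Rightarrow> real"
  where "shuffle_array t n k =
    (if k < n then (\<Prod>i<n. 1 + t * (real i - real k)) / fact n else 0)"

lemma shuffle_array_step:
  assumes "k < n"
  shows "real (n + 1) * shuffle_array t (n + 1) k
      = (1 + t * (real n - real k)) * shuffle_array t n k"
    and "real (n + 1) * shuffle_array t (n + 1) (k + 1)
      = (1 - t * (real k + 1)) * shuffle_array t n k"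
proof -
  show "real (n + 1) * shuffle_array t (n + 1) k
      = (1 + t * (real n - real k)) * shuffle_array t n k"
    using assms by (simp add: shuffle_array_def mult.commute del: of_nat_Suc)
  have "(\<Prod>i<Suc n. 1 + t * (real i - real (k + 1)))
      = (1 - t * (real k + 1)) * (\<Prod>i<n. 1 + t * (real i - real k))"
    by (subst prod.lessThan_Suc_shift) (simp add: algebra_simps)
  then show "real (n + 1) * shuffle_array t (n + 1) (k + 1)
      = (1 - t * (real k + 1)) * shuffle_array t n k"
    using assms by (simp add: shuffle_array_def del: of_nat_Suc prod.lessThan_Suc)
qed

lemma shuffle_array_recursion:
  assumes "k < n"
  shows "shuffle_array t n k = (real k + 1) * shuffle_array t (n + 1) k
    + (real n - real k) * shuffle_array t (n + 1) (k + 1)"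
proof -
  have "real (n + 1) * ((real k + 1) * shuffle_array t (n + 1) k
      + (real n - real k) * shuffle_array t (n + 1) (k + 1))
    = (real k + 1) * (real (n + 1) * shuffle_array t (n + 1) k)
      + (real n - real k) * (real (n + 1) * shuffle_array t (n + 1) (k + 1))"
    by (simp only: distrib_left mult.left_commute)
  also have "\<dots> = real (n + 1) * shuffle_array t n k"
    unfolding shuffle_array_step[OF assms] by (simp add: algebra_simps)
  finally show ?thesis by simp
qed

lemma tilt_shuffle_array: "tilt (shuffle_array t) n k = (1 + t) / 2 * shuffle_array t n k"
proof (cases "k < n")
  case True
  have "real (n + 1) * (shuffle_array t (n + 1) k - shuffle_array t (n + 1) (k + 1))
      = real (n + 1) * (t * shuffle_array t n k)"
    unfolding right_diff_distrib shuffle_array_step[OF True] by (simp add: algebra_simps)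
  then have "shuffle_array t (n + 1) k - shuffle_array t (n + 1) (k + 1) = t * shuffle_array t n k"
    by simp
  then show ?thesis
    using True by (simp add: tilt_def field_simps)
qed (simp add: tilt_def shuffle_array_def)

text \<open>
  On the entries \<open>V (n + 1) k\<close> and \<open>V (n + 1) (k + 1)\<close> the recursion and the eigenvalue equation
  at \<open>(n, k)\<close> form a nonsingular linear system, so level \<open>n\<close> determines level \<open>n + 1\<close>.
\<close>

lemma tilt_eigenarray_unique:
  assumes V: "V \<in> eulerian_arrays" and eigen: "\<And>n k. tilt V n k = \<theta> * V n k"
  shows "V = shuffle_array (2 * \<theta> - 1)"
proof -
  define t where "t = 2 * \<theta> - 1"
  have cone: "V \<in> eulerian_cone" and one: "V 1 0 = 1"
    using V by (simp_all add: eulerian_arrays_eq_cone)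
  have step: "real (n + 1) * V (n + 1) k = (1 + t * (real n - real k)) * V n k"
    "real (n + 1) * V (n + 1) (k + 1) = (1 - t * (real k + 1)) * V n k" if k: "k < n" for n k
  proof -
    have "V (n + 1) k - V (n + 1) (k + 1) = t * V n k"
      using eigen[of n k] k by (simp add: tilt_def t_def field_simps)
    then have diff: "V (n + 1) k = V (n + 1) (k + 1) + t * V n k"
      by simp
    have "V n k = real (n + 1) * V (n + 1) (k + 1) + (real k + 1) * (t * V n k)"
      using eulerian_coneD(3)[OF cone k] unfolding diff by (simp add: algebra_simps)
    then show "real (n + 1) * V (n + 1) (k + 1) = (1 - t * (real k + 1)) * V n k"
      by (simp add: algebra_simps)
    then show "real (n + 1) * V (n + 1) k = (1 + t * (real n - real k)) * V n k"
      unfolding diff by (simp add: algebra_simps)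
  qed
  have level: "\<forall>k < Suc n. V (Suc n) k = shuffle_array t (Suc n) k" for n
  proof (induction n)
    case 0
    then show ?case using one by (simp add: shuffle_array_def)
  next
    case (Suc n)
    show ?case
    proof (intro allI impI)
      fix k assume k: "k < Suc (Suc n)"
      have "real (Suc n + 1) * V (Suc n + 1) k
          = real (Suc n + 1) * shuffle_array t (Suc n + 1) k"
      proof (cases "k < Suc n")
        case True
        show ?thesis
          unfolding step(1)[OF True] shuffle_array_step(1)[OF True] using True Suc.IH by simp
      next
        case False
        then have kn: "k = n + 1" and n: "n < Suc n" using k by auto
        show ?thesis
          unfolding kn step(2)[OF n] shuffle_array_step(2)[OF n] using Suc.IH by simp
      qed
      then show "V (Suc (Suc n)) k = shuffle_array t (Suc (Suc n)) k"
        by (simp del: of_nat_Suc)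
    qed
  qed
  have "V n k = shuffle_array t n k" for n k
  proof (cases "k < n")
    case True
    then obtain n' where "n = Suc n'" by (cases n) auto
    then show ?thesis using level True by blast
  qed (simp add: eulerian_coneD(2)[OF cone] shuffle_array_def)
  then show ?thesis
    unfolding t_def by blast
qed


section \<open>Nonnegativity of the eigenarrays\<close>

lemma Theta_iff:
  "\<theta> \<in> Theta \<longleftrightarrow> 2 * \<theta> - 1 = 0 \<or> (\<exists>m::nat. \<bar>2 * \<theta> - 1\<bar> = 1 / (real m + 1))"
proof -
  have "\<theta> = 1/2 * (real m / (real m + 1)) \<longleftrightarrow> 2 * \<theta> - 1 = - (1 / (real m + 1))" for m
    by (simp add: field_simps)
  moreover have "\<theta> = 1/2 * ((real m + 2) / (real m + 1)) \<longleftrightarrow> 2 * \<theta> - 1 = 1 / (real m + 1)" for m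
    by (simp add: field_simps)
  moreover have "\<bar>x\<bar> = 1 / (real m + 1) \<longleftrightarrow> x = 1 / (real m + 1) \<or> x = - (1 / (real m + 1))"
    for x :: real and m
    by (auto simp: abs_if)
  moreover have "\<theta> = 1/2 \<longleftrightarrow> 2 * \<theta> - 1 = 0"
    by linarith
  ultimately show ?thesis
    unfolding Theta_def by blast
qed

text \<open>
  The numbers \<open>i - k\<close> for \<open>i < n\<close> form a set of consecutive integers that contains \<open>0\<close>. If a
  factor \<open>1 + t (i - k)\<close> is negative, then the set reaches beyond the integer \<open>- 1 / t\<close>, so it
  contains that integer, which contributes a factor \<open>0\<close>.
\<close>

lemma shuffle_array_nonneg:
  assumes "t = 0 \<or> (\<exists>m::nat. \<bar>t\<bar> = 1 / (real m + 1))"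
  shows "0 \<le> shuffle_array t n k"
proof (cases "k < n \<and> (\<exists>i<n. 1 + t * (real i - real k) < 0)")
  case False
  then have "k < n \<Longrightarrow> 0 \<le> (\<Prod>i<n. 1 + t * (real i - real k))"
    by (intro prod_nonneg) (metis lessThan_iff not_less)
  then show ?thesis by (simp add: shuffle_array_def)
next
  case True
  then obtain i where k: "k < n" and i: "i < n" and neg: "1 + t * (real i - real k) < 0"
    by blast
  then have "t \<noteq> 0" by auto
  then obtain m :: nat where m: "\<bar>t\<bar> = 1 / (real m + 1)"
    using assms by blast
  have "\<exists>j<n. 1 + t * (real j - real k) = 0"
  proof (cases "t > 0")
    case True
    then have t: "t = 1 / (real m + 1)" using m by simp
    from neg have "real i + (real m + 1) < real k"
      unfolding t by (simp add: field_simps)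
    then have "m + 1 \<le> k" by linarith
    then have "1 + t * (real (k - (m + 1)) - real k) = 0"
      unfolding t by (simp add: of_nat_diff field_simps)
    moreover have "k - (m + 1) < n" using k by simp
    ultimately show ?thesis by blast
  next
    case False
    then have t: "t = - (1 / (real m + 1))" using m by linarith
    from neg have "real k + (real m + 1) < real i"
      unfolding t by (simp add: field_simps)
    then have "k + (m + 1) < n" using i by linarith
    moreover have "1 + t * (real (k + (m + 1)) - real k) = 0"
      unfolding t by (simp add: add.commute)
    ultimately show ?thesis by blast
  qed
  then have "(\<Prod>i<n. 1 + t * (real i - real k)) = 0"
    by (auto intro!: prod_zero)
  then show ?thesis unfolding shuffle_array_def by (simp only: div_0 if_cancel order_refl)
qed

text \<open>
  If \<open>1 / \<bar>t\<bar>\<close> is not an integer, let \<open>m\<close> be its integer part. Then the factors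
  \<open>1, 1 - \<bar>t\<bar>, \<dots>, 1 - m \<bar>t\<bar>\<close> are positive and \<open>1 - (m + 1) \<bar>t\<bar>\<close> is negative. An entry at the
  end of row \<open>m + 2\<close> has exactly these factors: the last one for \<open>t > 0\<close>, the first for \<open>t < 0\<close>.
\<close>

lemma shuffle_array_nonneg_imp:
  assumes nonneg: "\<And>n k. 0 \<le> shuffle_array t n k"
  shows "t = 0 \<or> (\<exists>m::nat. \<bar>t\<bar> = 1 / (real m + 1))"
proof (rule ccontr)
  assume contra: "\<not> ?thesis"
  define s where "s = \<bar>t\<bar>"
  have s0: "s > 0" using contra by (simp add: s_def)
  define m where "m = nat \<lfloor>1 / s\<rfloor>"
  have m_le: "real m \<le> 1 / s" and m_gt: "1 / s < real m + 1"
    using s0 by (simp_all add: m_def)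
  have "real m \<noteq> 1 / s"
  proof
    assume eq: "real m = 1 / s"
    then have "m \<noteq> 0" using s0 by (metis of_nat_0 zero_less_divide_1_iff less_irrefl)
    then obtain m' where m': "m = Suc m'" by (cases m) auto
    then have "s = 1 / (real m' + 1)" using eq s0 by (simp add: field_simps)
    then show False using contra by (simp add: s_def)
  qed
  then have pos: "1 - s * real m > 0" and neg: "1 - s * (real m + 1) < 0"
    using m_le m_gt s0 by (simp_all add: field_simps)
  have pos_prod: "(\<Prod>i<m + 1. 1 - s * real i) > 0"
  proof (rule prod_pos)
    fix i assume "i \<in> {..<m + 1}"
    then have "s * real i \<le> s * real m"
      using s0 by (intro mult_left_mono) auto
    then show "1 - s * real i > 0" using pos by linarith
  qed
  then have neg_prod: "(\<Prod>i<m + 2. 1 - s * real i) < 0"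
    using neg by (simp add: mult_pos_neg add.commute)
  have "\<exists>k < m + 2. (\<Prod>i<m + 2. 1 + t * (real i - real k)) = (\<Prod>i<m + 2. 1 - s * real i)"
  proof (cases "t > 0")
    case True
    have "(\<Prod>i<m + 2. 1 + t * (real i - real (m + 1))) = (\<Prod>i<m + 2. 1 - s * real i)"
    proof (subst prod.nat_diff_reindex[symmetric], rule prod.cong)
      fix i assume "i \<in> {..<m + 2}"
      then have "real (m + 2 - Suc i) = real (m + 1) - real i"
        by (simp add: of_nat_diff)
      then show "1 + t * (real (m + 2 - Suc i) - real (m + 1)) = 1 - s * real i"
        using True by (simp add: s_def)
    qed simp
    then show ?thesis by (intro exI[of _ "m + 1"]) simp
  next
    case False
    then have "(\<Prod>i<m + 2. 1 + t * (real i - real 0)) = (\<Prod>i<m + 2. 1 - s * real i)"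
      by (intro prod.cong) (simp_all add: s_def)
    then show ?thesis by (intro exI[of _ 0]) simp
  qed
  then obtain k where "k < m + 2"
    "(\<Prod>i<m + 2. 1 + t * (real i - real k)) = (\<Prod>i<m + 2. 1 - s * real i)"
    by blast
  then have "shuffle_array t (m + 2) k = (\<Prod>i<m + 2. 1 - s * real i) / fact (m + 2)"
    by (simp only: shuffle_array_def if_True)
  also have "\<dots> < 0"
    by (rule divide_neg_pos[OF neg_prod fact_gt_zero])
  finally show False
    using nonneg[of "m + 2" k] by linarith
qed

lemma shuffle_array_in_eulerian_arrays:
  assumes "\<theta> \<in> Theta"
  shows "shuffle_array (2 * \<theta> - 1) \<in> eulerian_arrays"
  unfolding eulerian_arrays_eq_cone
proof
  show "shuffle_array (2 * \<theta> - 1) \<in> eulerian_cone"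
  proof (rule eulerian_coneI)
    show "0 \<le> shuffle_array (2 * \<theta> - 1) n k" for n k
      using assms unfolding Theta_iff by (rule shuffle_array_nonneg)
  qed (simp add: shuffle_array_def, rule shuffle_array_recursion)
qed (simp add: shuffle_array_def)

lemma shuffle_array_2_0: "shuffle_array (2 * \<theta> - 1) 2 0 = \<theta>"
  by (simp add: shuffle_array_def numeral_2_eq_2)

lemma continuous_on_shuffle_array: "continuous_on S (\<lambda>\<theta>. shuffle_array (2 * \<theta> - 1))"
proof (intro continuous_on_coordinatewise_then_product)
  show "continuous_on S (\<lambda>\<theta>. shuffle_array (2 * \<theta> - 1) n k)" for n k
    unfolding shuffle_array_def by (cases "k < n") (auto intro!: continuous_intros)
qed


section \<open>Extreme arrays are exactly the eigenarrays\<close>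

lemma extreme_array_is_eigenarray:
  assumes ext: "V \<in> extreme_arrays"
  shows "tilt V n k = V 2 0 * V n k"
proof -
  define \<theta> where "\<theta> = V 2 0"
  have V: "V extreme_point_of eulerian_arrays"
    using ext by (simp add: extreme_arrays_def)
  then have "V \<in> eulerian_arrays"
    by (simp add: extreme_point_of_def)
  then have cone: "V \<in> eulerian_cone" and one: "V 1 0 = 1"
    by (simp_all add: eulerian_arrays_eq_cone)
  note P = tilt_in_cone[OF cone] and Q = tilt_complement_in_cone[OF cone]
  have P10: "tilt V 1 0 = \<theta>"
    using tilt_1_0[OF cone] by (simp add: \<theta>_def)
  have Q10: "V 1 0 - tilt V 1 0 = 1 - \<theta>"
    using P10 one by simp
  have "0 \<le> \<theta>" "\<theta> \<le> 1"
    using eulerian_coneD(1)[OF P, of 1 0] eulerian_coneD(1)[OF Q, of 1 0] P10 Q10 by simp_all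
  then consider "\<theta> = 0" | "\<theta> = 1" | "0 < \<theta>" "\<theta> < 1" by linarith
  then have "tilt V n k = \<theta> * V n k"
  proof cases
    case 1
    then show ?thesis using eulerian_cone_vanishes[OF P, of n k] P10 by simp
  next
    case 2
    then show ?thesis using eulerian_cone_vanishes[OF Q, of n k] Q10 by simp
  next
    case 3
    define A where "A = (\<lambda>n k. (1 / \<theta>) * tilt V n k)"
    define B where "B = (\<lambda>n k. (1 / (1 - \<theta>)) * (V n k - tilt V n k))"
    have A: "A \<in> eulerian_arrays"
      unfolding eulerian_arrays_eq_cone
    proof
      show "A \<in> eulerian_cone"
        unfolding A_def by (rule eulerian_cone_scale[OF P]) (use 3 in simp)
      show "A 1 0 = 1"
        unfolding A_def P10 using 3 by simp
    qed
    have B: "B \<in> eulerian_arrays"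
      unfolding eulerian_arrays_eq_cone
    proof
      show "B \<in> eulerian_cone"
        unfolding B_def by (rule eulerian_cone_scale[OF Q]) (use 3 in simp)
      show "B 1 0 = 1"
        unfolding B_def Q10 using 3 by simp
    qed
    have mix: "V = (1 - \<theta>) *\<^sub>R B + \<theta> *\<^sub>R A"
      using 3 by (simp add: fun_eq_iff A_def B_def)
    have "A = B"
    proof (rule ccontr)
      assume "A \<noteq> B"
      then have "V \<in> open_segment B A"
        unfolding in_segment using mix 3 by blast
      then show False
        using V A B unfolding extreme_point_of_def by blast
    qed
    then have "V = A"
      using mix by (simp add: fun_eq_iff algebra_simps)
    then have "V n k = A n k"
      by (rule fun_cong[OF fun_cong])
    also have "\<dots> = (1 / \<theta>) * tilt V n k"
      by (simp add: A_def)
    finally show ?thesis using 3 by simp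
  qed
  then show ?thesis by (simp add: \<theta>_def)
qed

text \<open>
  Expand \<open>1 = (P + (1 - P))\<^sup>N\<close> binomially and weight the \<open>k\<close>-th term, which is positive, with
  \<open>(k - z)\<^sup>2\<close>: the first two moments of the binomial distribution turn the weighted sum into the
  operator below. Splitting off one factor \<open>P + (1 - P)\<close> makes this an induction on \<open>N\<close>.
\<close>

lemma tilt_binomial_moment_nonneg:
  assumes "V \<in> eulerian_cone"
  shows "0 \<le> real N * (real N - 1) * tilt (tilt V) n k
    + real N * (1 - 2 * z) * tilt V n k + z\<^sup>2 * V n k"
  using assms
proof (induction N arbitrary: V z)
  case 0
  then show ?case using eulerian_coneD(1)[OF 0] by simp
next
  case (Suc N)
  note first_P = Suc.IH[OF tilt_in_cone[OF Suc.prems], of "z - 1"]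
    and first_Q = Suc.IH[OF tilt_complement_in_cone[OF Suc.prems], of z]
  have compl: "tilt (\<lambda>n k. U n k - tilt U n k) n k = tilt U n k - tilt (tilt U) n k" for U n k
    using tilt_linear[of 1 U "-1" "tilt U"] by simp
  have "tilt (\<lambda>n k. V n k - tilt V n k) = (\<lambda>n k. tilt V n k - tilt (tilt V) n k)"
    by (simp add: compl fun_eq_iff)
  then have compl2: "tilt (tilt (\<lambda>n k. V n k - tilt V n k)) n k
      = tilt (tilt V) n k - tilt (tilt (tilt V)) n k"
    using compl[of "tilt V"] by simp
  show ?case
    using add_nonneg_nonneg[OF first_P first_Q] unfolding compl compl2
    by (simp add: power2_eq_square algebra_simps)
qed

text \<open>
  With \<open>z = s N\<close> the preceding bound is \<open>N\<^sup>2 (P - s)\<^sup>2 V + O(N)\<close>, so its leading coefficient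
  cannot be negative.
\<close>

lemma tilt_square_nonneg:
  assumes V: "V \<in> eulerian_cone"
  shows "0 \<le> tilt (tilt V) n k - 2 * s * tilt V n k + s\<^sup>2 * V n k"
proof (rule ccontr)
  define q where "q = tilt (tilt V) n k - 2 * s * tilt V n k + s\<^sup>2 * V n k"
  define d where "d = tilt V n k - tilt (tilt V) n k"
  assume "\<not> ?thesis"
  then have q: "q < 0" by (simp add: q_def)
  then obtain N :: nat where N: "d / (- q) < real N"
    using reals_Archimedean2 by blast
  have "d \<ge> 0"
    using eulerian_coneD(1)[OF tilt_complement_in_cone[OF tilt_in_cone[OF V]]] by (simp add: d_def)
  then have "0 \<le> d / (- q)"
    using q by (intro divide_nonneg_pos) auto
  with N have N0: "real N > 0" by linarith
  have "0 \<le> real N * (real N * q + d)"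
    using tilt_binomial_moment_nonneg[OF V, of N n k "s * real N"]
    by (simp add: q_def d_def power2_eq_square algebra_simps)
  then have "0 \<le> real N * q + d"
    using N0 by (simp add: zero_le_mult_iff)
  moreover have "real N * q + d < 0"
    using N q by (simp add: field_simps)
  ultimately show False by linarith
qed

text \<open>
  A vanishing second moment about \<open>\<theta>\<close> forces the first moment about \<open>\<theta>\<close> to vanish, since the
  second moment about any other point is nonnegative as well.
\<close>

lemma tilt_eigenarray_if_square_zero:
  assumes V: "V \<in> eulerian_cone"
    and zero: "tilt (tilt V) n k - 2 * \<theta> * tilt V n k + \<theta>\<^sup>2 * V n k = 0"
  shows "tilt V n k = \<theta> * V n k"
proof -
  define c where "c = V n k"
  define d where "d = \<theta> * c - tilt V n k"
  have c: "c \<ge> 0"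
    using eulerian_coneD(1)[OF V] by (simp add: c_def)
  have quad: "0 \<le> h\<^sup>2 * c + 2 * h * d" for h
    using tilt_square_nonneg[OF V, of n k "\<theta> + h"] zero
    by (simp add: c_def d_def power2_eq_square algebra_simps)
  \<comment> \<open>A point between \<open>0\<close> and the other root \<open>- 2 d / c\<close> of the quadratic; the summand \<open>1\<close>
    covers \<open>c = 0\<close>.\<close>
  have "0 \<le> (- d / (c + 1))\<^sup>2 * c + 2 * (- d / (c + 1)) * d"
    by (rule quad)
  also have "\<dots> = - (d\<^sup>2 * (c + 2) / (c + 1)\<^sup>2)"
    using c by (simp add: power2_eq_square divide_simps) (simp add: algebra_simps)
  finally have "d\<^sup>2 * (c + 2) / (c + 1)\<^sup>2 \<le> 0" by simp
  then have "d = 0"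
    using c by (auto simp: divide_le_0_iff mult_le_0_iff zero_le_power2 not_le power2_eq_square)
  then show ?thesis by (simp add: d_def c_def)
qed

lemma eigenarray_is_extreme:
  assumes V: "V \<in> eulerian_arrays" and eigen: "\<And>n k. tilt V n k = \<theta> * V n k"
  shows "V \<in> extreme_arrays"
proof -
  have "V \<notin> open_segment A B" if A: "A \<in> eulerian_arrays" and B: "B \<in> eulerian_arrays" for A B
  proof
    assume "V \<in> open_segment A B"
    then obtain u where "A \<noteq> B" and u: "0 < u" "u < 1" and mix: "V = (1 - u) *\<^sub>R A + u *\<^sub>R B"
      unfolding in_segment by blast
    have coneA: "A \<in> eulerian_cone" and coneB: "B \<in> eulerian_cone"
      using A B by (simp_all add: eulerian_arrays_eq_cone)
    have V_mix: "V = (\<lambda>n k. (1 - u) * A n k + u * B n k)"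
      using mix by (simp add: fun_eq_iff)
    have tilt_mix: "tilt V = (\<lambda>n k. (1 - u) * tilt A n k + u * tilt B n k)"
      unfolding V_mix by (simp add: tilt_linear fun_eq_iff)
    have tilt2_mix: "tilt (tilt V) = (\<lambda>n k. (1 - u) * tilt (tilt A) n k + u * tilt (tilt B) n k)"
      unfolding tilt_mix by (simp add: tilt_linear fun_eq_iff)
    have "tilt V = (\<lambda>n k. \<theta> * V n k)"
      using eigen by (simp add: fun_eq_iff)
    then have tilt2: "tilt (tilt V) n k = \<theta> * (\<theta> * V n k)" for n k
      using eigen[of n k] tilt_linear[of \<theta> V 0 V n k] by simp
    define qA where "qA n k = tilt (tilt A) n k - 2 * \<theta> * tilt A n k + \<theta>\<^sup>2 * A n k" for n k
    define qB where "qB n k = tilt (tilt B) n k - 2 * \<theta> * tilt B n k + \<theta>\<^sup>2 * B n k" for n k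
    have q: "qA n k = 0 \<and> qB n k = 0" for n k
    proof -
      have "(1 - u) * qA n k + u * qB n k
          = tilt (tilt V) n k - 2 * \<theta> * tilt V n k + \<theta>\<^sup>2 * V n k"
        unfolding fun_cong[OF fun_cong[OF tilt2_mix]] fun_cong[OF fun_cong[OF tilt_mix]]
          fun_cong[OF fun_cong[OF V_mix], of n k] qA_def qB_def
        by (simp add: algebra_simps)
      also have "\<dots> = 0"
        unfolding tilt2 eigen by (simp add: power2_eq_square)
      finally have "(1 - u) * qA n k + u * qB n k = 0" .
      moreover have "0 \<le> qA n k" "0 \<le> qB n k"
        using tilt_square_nonneg[OF coneA] tilt_square_nonneg[OF coneB]
        by (simp_all add: qA_def qB_def)
      ultimately show ?thesis
        using u by (simp add: add_nonneg_eq_0_iff)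
    qed
    have "A = shuffle_array (2 * \<theta> - 1)"
      using q by (intro tilt_eigenarray_unique[OF A] tilt_eigenarray_if_square_zero[OF coneA])
        (simp add: qA_def)
    moreover have "B = shuffle_array (2 * \<theta> - 1)"
      using q by (intro tilt_eigenarray_unique[OF B] tilt_eigenarray_if_square_zero[OF coneB])
        (simp add: qB_def)
    ultimately show False
      using \<open>A \<noteq> B\<close> by simp
  qed
  then show ?thesis
    using V by (auto simp: extreme_arrays_def extreme_point_of_def)
qed


section \<open>The homeomorphism\<close>

lemma extreme_array_eq_shuffle_array:
  assumes "W \<in> extreme_arrays"
  shows "W = shuffle_array (2 * W 2 0 - 1)"
proof (rule tilt_eigenarray_unique)
  show "W \<in> eulerian_arrays"
    using assms by (simp add: extreme_arrays_def extreme_point_of_def)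
qed (rule extreme_array_is_eigenarray[OF assms])

lemma extreme_array_2_0_in_Theta:
  assumes "W \<in> extreme_arrays"
  shows "W 2 0 \<in> Theta"
proof -
  have "W \<in> eulerian_cone"
    using assms by (simp add: extreme_arrays_def extreme_point_of_def eulerian_arrays_eq_cone)
  then have "0 \<le> shuffle_array (2 * W 2 0 - 1) n k" for n k
    using eulerian_coneD(1) extreme_array_eq_shuffle_array[OF assms] by metis
  then show ?thesis
    unfolding Theta_iff by (rule shuffle_array_nonneg_imp)
qed

lemma shuffle_array_extreme:
  assumes "\<theta> \<in> Theta"
  shows "shuffle_array (2 * \<theta> - 1) \<in> extreme_arrays"
proof (rule eigenarray_is_extreme)
  show "tilt (shuffle_array (2 * \<theta> - 1)) n k = \<theta> * shuffle_array (2 * \<theta> - 1) n k" for n k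
    by (simp add: tilt_shuffle_array)
qed (rule shuffle_array_in_eulerian_arrays[OF assms])

theorem theorem1:
  shows "inj_on (\<lambda>W. W 2 0) extreme_arrays
    \<and> (\<forall>W \<in> extreme_arrays. W 2 0 \<in> Theta)
    \<and> (\<exists>g. homeomorphism extreme_arrays Theta (\<lambda>W. W 2 0) g)"
proof (intro conjI ballI exI)
  show "inj_on (\<lambda>W. W 2 0) extreme_arrays"
    by (rule inj_on_inverseI[where g = "\<lambda>\<theta>. shuffle_array (2 * \<theta> - 1)"])
      (rule extreme_array_eq_shuffle_array[symmetric])
  show "W 2 0 \<in> Theta" if "W \<in> extreme_arrays" for W
    by (rule extreme_array_2_0_in_Theta[OF that])
  show "homeomorphism extreme_arrays Theta (\<lambda>W. W 2 0) (\<lambda>\<theta>. shuffle_array (2 * \<theta> - 1))"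
  proof (rule homeomorphismI)
    show "continuous_on extreme_arrays (\<lambda>W. W 2 0)"
      by (rule continuous_on_product_then_coordinatewise[where i = 0,
            OF continuous_on_product_then_coordinatewise[where i = 2, OF continuous_on_id]])
    show "continuous_on Theta (\<lambda>\<theta>. shuffle_array (2 * \<theta> - 1))"
      by (rule continuous_on_shuffle_array)
    show "(\<lambda>W. W 2 0) ` extreme_arrays \<subseteq> Theta"
      using extreme_array_2_0_in_Theta by blast
    show "(\<lambda>\<theta>. shuffle_array (2 * \<theta> - 1)) ` Theta \<subseteq> extreme_arrays"
      using shuffle_array_extreme by blast
  qed (rule extreme_array_eq_shuffle_array[symmetric], assumption, rule shuffle_array_2_0)
qed

end
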